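(* Let $k$ be a positive integer and $T$ a string of length $n$. The total number of (maximal) uniform $k$-runs in $T$, over all periods $\ell\in[1\mathinner{.\,.}\lfloor n/2\rfloor]$, is $\mathcal{O}(nk\log k)$.
   Context: $T[i\mathinner{.\,.} j)=T[i]\cdots T[j-1]$, positions numbered from 1. A uniform $k$-run of period $\ell$ is a substring $T[a\mathinner{.\,.} b)$ with $b-a\ge 2\ell$ such that the sets $\{j\in[i\mathinner{.\,.} i+\ell): T[j]\ne T[j+\ell]\}$ for all $i\in[a\mathinner{.\,.} b-2\ell]$ have cardinality at most $k$ and are all equal; it is maximal if it cannot be extended to the left or to the right by a position while remaining a uniform $k$-run of period $\ell$. A uniform $k$-run is identified by the triple $(a,b,\ell)$.
   Formalization: The factor log k is read as max(1, log₂ k): at k = 1 the bound nk log k would be 0, while T = aa already has one maximal uniform 1-run; for every k ≥ 2 the bound is exactly O(nk log k), and for k = 1 it reads O(n). *)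

theory Defs
  imports Complex_Main
begin

text \<open>
  Strings are lists over an arbitrary alphabet with positions numbered from 1, so only
  positions between 1 and the length of the list are meaningful.
\<close>

definition char_at :: "'a list \<Rightarrow> nat \<Rightarrow> 'a" where
  "char_at T j = T ! (j - 1)"

definition mismatches :: "'a list \<Rightarrow> nat \<Rightarrow> nat \<Rightarrow> nat set" where
  "mismatches T l i = {j \<in> {i..<i + l}. char_at T j \<noteq> char_at T (j + l)}"

text \<open>
  The fragment is half-open, hence the bound \<open>b \<le> length T + 1\<close>. The subtraction
  \<open>b - 2 * l\<close> never truncates, as \<open>a + 2 * l \<le> b\<close>.
\<close>

definition uniform_run :: "nat \<Rightarrow> 'a list \<Rightarrow> nat \<Rightarrow> nat \<Rightarrow> nat \<Rightarrow> bool" where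
  "uniform_run k T a b l \<longleftrightarrow>
     1 \<le> l \<and> 1 \<le> a \<and> b \<le> length T + 1 \<and> a + 2 * l \<le> b \<and>
     (\<forall>i \<in> {a..b - 2 * l}. card (mismatches T l i) \<le> k) \<and>
     (\<forall>i \<in> {a..b - 2 * l}. \<forall>i' \<in> {a..b - 2 * l}. mismatches T l i = mismatches T l i')"

text \<open>
  An extension beyond either end of the string is never a \<^const>\<open>uniform_run\<close>; in
  particular, for \<open>a = 1\<close> the start \<open>a - 1\<close> is the illegal position 0.
\<close>

definition maximal_uniform_run :: "nat \<Rightarrow> 'a list \<Rightarrow> nat \<Rightarrow> nat \<Rightarrow> nat \<Rightarrow> bool" where
  "maximal_uniform_run k T a b l \<longleftrightarrow>
     uniform_run k T a b l \<and>
     \<not> uniform_run k T (a - 1) b l \<and>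
     \<not> uniform_run k T a (b + 1) l"

definition maximal_uniform_runs :: "nat \<Rightarrow> 'a list \<Rightarrow> (nat \<times> nat \<times> nat) set" where
  "maximal_uniform_runs k T =
     {(a, b, l). l \<in> {1..length T div 2} \<and> maximal_uniform_run k T a b l}"

lemma uniform_run_bounds:
  assumes "uniform_run k T a b l"
  shows "1 \<le> l" "1 \<le> a" "b \<le> length T + 1" "a + 2 * l \<le> b"
  using assms unfolding uniform_run_def by blast+

lemma finite_maximal_uniform_runs: "finite (maximal_uniform_runs k T)"
proof (rule finite_subset)
  show "maximal_uniform_runs k T \<subseteq>
      {..length T + 1} \<times> {..length T + 1} \<times> {..length T + 1}"
    unfolding maximal_uniform_runs_def maximal_uniform_run_def
    using uniform_run_bounds[of k T] by fastforce
qed simp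

end

theory Submission
  imports Defs
begin

text \<open>
  Call \<open>j\<close> an \<open>l\<close>-mismatch if \<open>T[j] \<noteq> T[j + l]\<close>. A maximal run of period \<open>l\<close> that does not end at
  the end of the string is determined by a window \<open>[i, i + l)\<close> with at most \<open>k\<close> mismatches such
  that \<open>i\<close> or \<open>i + l\<close> is a mismatch; by reversal it suffices to treat the first case. Distribute
  the charge 1 of such a window over the mismatch-free gaps inside it, proportionally to their
  length. Gaps shorter than \<open>l / (2 k)\<close> carry at most half of the charge, and a gap of length \<open>g\<close>
  is charged by at most \<open>k\<close> windows, so it remains to bound the sum of \<open>g / l\<close> over all gaps with
  \<open>g \<ge> l / (2 k)\<close> by \<open>O(n log k)\<close>.

  Classify the gaps by \<open>g \<approx> 2 h\<close>, \<open>h = 2 ^ m\<close>, and \<open>l \<approx> 2 ^ p\<close>; for every \<open>m\<close> only \<open>O(log k)\<close> values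
  of \<open>p\<close> matter. A gap contains a block of length \<open>h\<close> starting at a multiple of \<open>h\<close>, which recurs
  at distance \<open>l\<close>. Occurrences of a word are separated by its least period, so blocks with least
  period above \<open>h / 8\<close> contribute \<open>O(n / h)\<close>. If the least period \<open>q\<close> of the block is at most
  \<open>h / 8\<close>, the mismatch preceding the gap forces the \<open>q\<close>-periodic stretch around the block or
  around its copy to start inside the gap, and that start determines the gap for given \<open>l\<close>. Each
  such start contributes \<open>O(h / q)\<close>, and by the theorem of Fine and Wilf stretches with periods in
  \<open>[Q, 2 Q)\<close> hardly overlap, so that these contributions sum up to \<open>O(n)\<close>.
\<close>

section \<open>Periods\<close>

definition has_period :: "(nat \<Rightarrow> 'a) \<Rightarrow> nat \<Rightarrow> nat \<Rightarrow> nat \<Rightarrow> bool" where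
  "has_period f x h q \<longleftrightarrow> 0 < q \<and> (\<forall>j. x \<le> j \<and> j + q < x + h \<longrightarrow> f j = f (j + q))"

lemma has_periodD: "has_period f x h q \<Longrightarrow> x \<le> j \<Longrightarrow> j + q < x + h \<Longrightarrow> f j = f (j + q)"
  by (simp add: has_period_def)

lemma has_period_pos: "has_period f x h q \<Longrightarrow> 0 < q"
  by (simp add: has_period_def)

lemma has_period_subinterval:
  "has_period f x h q \<Longrightarrow> x \<le> y \<Longrightarrow> y + g \<le> x + h \<Longrightarrow> has_period f y g q"
  by (auto simp: has_period_def)

text \<open>Shifting back by \<open>q\<close> leads into the part where \<open>r\<close> is known:
  \<open>f j = f (j - q) = f (j - q + r) = f (j + r)\<close>. The bound \<open>q + r \<le> M\<close>
  keeps \<open>j - q\<close> in the stretch.\<close>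

lemma has_period_extend_right:
  assumes "has_period f b M r" "has_period f b (M + e) q" "q + r \<le> M"
  shows "has_period f b (M + e) r"
  using assms(2)
proof (induction e)
  case 0
  then show ?case using assms(1) by simp
next
  case (Suc e)
  have IH: "has_period f b (M + e) r"
    using Suc.IH Suc.prems by (meson has_period_subinterval add_le_cancel_left le_refl le_SucI)
  have r: "0 < r" using assms(1) has_period_pos by blast
  have q: "0 < q" using assms(2) has_period_pos by blast
  have "f j = f (j + r)" if j: "b \<le> j" "j + r < b + (M + Suc e)" for j
  proof (cases "j + r < b + (M + e)")
    case True
    then show ?thesis using IH j has_periodD by metis
  next
    case False
    define i where "i = j - q"
    have i: "b \<le> i" "j = i + q" using False assms(3) i_def j by auto
    have "f i = f (i + q)"
      using has_periodD[OF Suc.prems, of i] i j r by simp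
    moreover have "f i = f (i + r)"
      using has_periodD[OF IH, of i] i j q by simp
    moreover have "f (i + r) = f (i + r + q)"
      using has_periodD[OF Suc.prems, of "i + r"] i j by simp
    ultimately show ?thesis using i by (simp add: add.commute add.left_commute)
  qed
  then show ?case using r by (simp add: has_period_def)
qed

lemma has_period_extend_left:
  assumes "has_period f b M r" "has_period f a (e + M) q" "q + r \<le> M" "b = a + e"
  shows "has_period f a (e + M) r"
  using assms(2,4)
proof (induction e arbitrary: a)
  case 0
  then show ?case using assms(1) by simp
next
  case (Suc e)
  have IH: "has_period f (Suc a) (e + M) r"
    using Suc.IH[of "Suc a"] Suc.prems has_period_subinterval[OF Suc.prems(1), of "Suc a" "e + M"] by simp
  have r: "0 < r" using assms(1) has_period_pos by blast
  have q: "0 < q" using assms(2) has_period_pos by blast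
  have "f j = f (j + r)" if j: "a \<le> j" "j + r < a + (Suc e + M)" for j
  proof (cases "Suc a \<le> j")
    case True
    then show ?thesis using has_periodD[OF IH, of j] j by simp
  next
    case False
    then have ja: "j = a" using j by simp
    have "f a = f (a + q)"
      using has_periodD[OF Suc.prems(1), of a] assms(3) r by simp
    moreover have "f (a + q) = f (a + q + r)"
      using has_periodD[OF IH, of "a + q"] assms(3) q by simp
    moreover have "f (a + r) = f (a + r + q)"
      using has_periodD[OF Suc.prems(1), of "a + r"] assms(3) by simp
    ultimately show ?thesis using ja by (simp add: add.commute add.left_commute)
  qed
  then show ?case using r by (simp add: has_period_def)
qed

lemma has_period_extend:
  assumes "has_period f b M r" "has_period f a N q" "q + r \<le> M" "a \<le> b" "b + M \<le> a + N"
  shows "has_period f a N r"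
proof -
  define e1 where "e1 = b - a"
  define e2 where "e2 = a + N - (b + M)"
  have N: "N = e1 + (M + e2)" and b: "b = a + e1" using assms e1_def e2_def by auto
  have "has_period f b (M + e2) q"
    using has_period_subinterval[OF assms(2), of b "M + e2"] N b by simp
  then have "has_period f b (M + e2) r"
    using has_period_extend_right[OF assms(1)] assms(3) by blast
  then show ?thesis
    using has_period_extend_left[of f b "M + e2" r a e1 q] assms(2,3) N b by simp
qed

text \<open>Subtractive Euclidean algorithm: for \<open>p < q\<close> the prefix of length
  \<open>N - p\<close> has the periods \<open>p\<close> and \<open>q - p\<close>. Their gcd, a
  period of the prefix by induction, spreads to the full stretch along the period
  \<open>p\<close>.\<close>

lemma fine_wilf:
  assumes "has_period f x N p" "has_period f x N q" "p + q \<le> N"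
  shows "has_period f x N (gcd p q)"
  using assms
proof (induction "p + q" arbitrary: p q N rule: less_induct)
  case less
  have pos: "0 < p" "0 < q" using less.prems has_period_pos by blast+
  have step: "has_period f x N (gcd p q)"
    if pq: "p < q" "has_period f x N p" "has_period f x N q" "p + q \<le> N" "0 < p"
      and IH: "\<And>N'. has_period f x N' p \<Longrightarrow> has_period f x N' (q - p) \<Longrightarrow> p + (q - p) \<le> N' \<Longrightarrow>
        has_period f x N' (gcd p (q - p))" for p q
  proof -
    have 1: "has_period f x (N - p) p"
      using has_period_subinterval[OF pq(2), of x "N - p"] by simp
    have 2: "has_period f x (N - p) (q - p)"
      unfolding has_period_def
    proof (intro conjI allI impI)
      show "0 < q - p" using pq by simp
      fix j assume j: "x \<le> j \<and> j + (q - p) < x + (N - p)"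
      then have jq: "j + q < x + N" using pq(1,4) by arith
      have "f j = f (j + q)" using has_periodD[OF pq(3), of j] j jq by simp
      moreover have "f (j + (q - p)) = f (j + (q - p) + p)"
        using has_periodD[OF pq(2), of "j + (q - p)"] j jq pq(1) trans_le_add1[of x j "q - p"] by simp
      ultimately show "f j = f (j + (q - p))" using pq(1) by simp
    qed
    have g: "gcd p (q - p) = gcd p q" using pq(1) by (metis gcd_diff1_nat gcd.commute less_imp_le)
    have 3: "has_period f x (N - p) (gcd p q)"
      using IH[OF 1 2] pq(1,4) g by simp
    \<comment> \<open>As a divisor of \<open>q - p\<close>, the gcd satisfies
      \<open>p + gcd p q \<le> q \<le> N - p\<close>, the overlap that the extension needs.\<close>
    have "gcd p q \<le> q - p" using g pq(1) by (metis gcd_le2_nat zero_less_diff not_gr0)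
    then have "p + gcd p q \<le> N - p" using pq(1,4) by simp
    then show ?thesis using has_period_extend[OF 3 pq(2)] by simp
  qed
  consider "p < q" | "q < p" | "p = q" by linarith
  then show ?case
  proof cases
    case 1
    show ?thesis
      using step[OF 1 less.prems pos(1)] less.hyps[of p "q - p"] 1 pos by simp
  next
    case 2
    have "has_period f x N (gcd q p)"
      using step[OF 2 less.prems(2,1) _ pos(2)] less.prems(3) less.hyps[of q "p - q"] 2 pos
      by (simp add: add.commute)
    then show ?thesis by (simp add: gcd.commute)
  next
    case 3
    then show ?thesis using less.prems by simp
  qed
qed

section \<open>Least periods of blocks and left ends of periodic stretches\<close>

definition least_period :: "(nat \<Rightarrow> 'a) \<Rightarrow> nat \<Rightarrow> nat \<Rightarrow> nat" where
  "least_period f x h = (LEAST q. has_period f x h q)"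

lemma has_period_length: "0 < h \<Longrightarrow> has_period f x h h"
  by (auto simp: has_period_def)

lemma has_period_least_period: "0 < h \<Longrightarrow> has_period f x h (least_period f x h)"
  unfolding least_period_def by (rule LeastI[of _ h]) (rule has_period_length)

lemma least_period_le: "has_period f x h q \<Longrightarrow> least_period f x h \<le> q"
  unfolding least_period_def by (rule Least_le)

lemma least_period_pos: "0 < h \<Longrightarrow> 0 < least_period f x h"
  using has_period_least_period has_period_pos by blast

lemma least_period_le_length: "0 < h \<Longrightarrow> least_period f x h \<le> h"
  by (simp add: has_period_length least_period_le)

text \<open>A smaller least period at \<open>y\<close> would, by Fine and Wilf, make its gcd with
  \<open>q\<close> a period of the whole stretch and hence of the block at \<open>x\<close>, against
  the minimality of \<open>q\<close>.\<close>

lemma least_period_shift: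
  assumes q: "q = least_period f x h" "2 * q \<le> h" and h: "0 < h"
    and y: "y \<le> x" "has_period f y (x + h - y) q"
  shows "least_period f y h = q"
proof -
  define q' where "q' = least_period f y h"
  have p: "has_period f y h q" using has_period_subinterval[OF y(2), of y h] y(1) by simp
  have q'p: "has_period f y h q'" using h has_period_least_period q'_def by blast
  have le: "q' \<le> q" using p least_period_le q'_def by blast
  define r where "r = gcd q q'"
  have r: "has_period f y h r" using fine_wilf[OF p q'p] q(2) le r_def by simp
  have r_le: "r \<le> q" "r \<le> q'" using r_def has_period_pos[OF p] has_period_pos[OF q'p]
    by (auto intro: gcd_le1_nat gcd_le2_nat)
  have "has_period f y (x + h - y) r"
    using has_period_extend[OF r y(2)] r_le q(2) y(1) by simp
  then have "has_period f x h r" using has_period_subinterval y(1) by fastforce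
  then have "q \<le> r" using q(1) least_period_le by blast
  then show ?thesis using r_le le q'_def by simp
qed

text \<open>Such a \<open>y\<close> is the left end of a maximal stretch with the least period of
  the block. The factor 8 ensures that half a block still has room for Fine and Wilf with two
  periods of the same dyadic size.\<close>

definition period_start :: "(nat \<Rightarrow> 'a) \<Rightarrow> nat \<Rightarrow> nat \<Rightarrow> bool" where
  "period_start f h y \<longleftrightarrow> 1 \<le> y \<and> 8 * least_period f y h \<le> h \<and>
     f (y - 1) \<noteq> f (y - 1 + least_period f y h)"

text \<open>Behind the last position before \<open>x\<close> at which the period \<open>q\<close>
  breaks, everything up to the end of the block is \<open>q\<close>-periodic. The break at
  \<open>d\<close> shows that such a position exists.\<close>

lemma period_start_exists:
  assumes h: "0 < h" and q: "q = least_period f x h" "8 * q \<le> h"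
    and d: "d < x" "f d \<noteq> f (d + q)"
  shows "\<exists>y. d < y \<and> y \<le> x \<and> period_start f h y \<and> least_period f y h = q"
proof -
  define j where "j = Max {j. j < x \<and> f j \<noteq> f (j + q)}"
  have fin: "finite {j. j < x \<and> f j \<noteq> f (j + q)}" by simp
  have "d \<in> {j. j < x \<and> f j \<noteq> f (j + q)}" using d by simp
  then have j: "j < x" "f j \<noteq> f (j + q)" "d \<le> j" and mx: "\<And>i. i < x \<Longrightarrow> f i \<noteq> f (i + q) \<Longrightarrow> i \<le> j"
    using Max_in[OF fin] Max_ge[OF fin] unfolding j_def by blast+
  have per: "has_period f x h q" using has_period_least_period h q by blast
  have "has_period f (Suc j) (x + h - Suc j) q"
    unfolding has_period_def
  proof (intro conjI allI impI)
    show "0 < q" using per has_period_pos by blast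
    fix i assume i: "Suc j \<le> i \<and> i + q < Suc j + (x + h - Suc j)"
    show "f i = f (i + q)"
    proof (cases "i < x")
      case True
      then show ?thesis using mx[of i] i by fastforce
    next
      case False
      then show ?thesis using has_periodD[OF per, of i] i j by simp
    qed
  qed
  then have "least_period f (Suc j) h = q"
    using least_period_shift[OF q(1) _ h, of "Suc j"] q(2) j by simp
  then show ?thesis using j q(2) by (intro exI[of _ "Suc j"]) (simp add: period_start_def)
qed

text \<open>Otherwise the two blocks share \<open>4 * Q\<close> letters, more than the sum of their
  periods, so the gcd is a period of both and by minimality the periods agree. But then
  \<open>y' - 1\<close> lies in the block at \<open>y\<close>, and the period cannot break
  there.\<close>

lemma period_start_gap:
  assumes s: "period_start f h y" "period_start f h' y'" and h: "0 < h" "0 < h'"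
    and Q: "Q \<le> least_period f y h" "least_period f y h < 2 * Q"
      "Q \<le> least_period f y' h'" "least_period f y' h' < 2 * Q"
    and "y < y'"
  shows "y + h div 2 < y'"
proof (rule ccontr)
  assume "\<not> ?thesis"
  then have y': "y' \<le> y + h div 2" by simp
  define q where "q = least_period f y h"
  define q' where "q' = least_period f y' h'"
  have q: "has_period f y h q" "has_period f y' h' q'"
    using h has_period_least_period q_def q'_def by blast+
  have le: "8 * q \<le> h" "8 * q' \<le> h'" using s by (auto simp: period_start_def q_def q'_def)
  have in1: "y \<le> y'" "y' + 4 * Q \<le> y + h" and in2: "y' + 4 * Q \<le> y' + h'"
    using assms(9) y' le Q q_def q'_def by auto
  define r where "r = gcd q q'"
  have r_le: "r \<le> q" "r \<le> q'" using r_def has_period_pos[OF q(1)] has_period_pos[OF q(2)]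
    by (auto intro: gcd_le1_nat gcd_le2_nat)
  have r: "has_period f y' (4 * Q) r"
    using fine_wilf[OF has_period_subinterval[OF q(1) in1] has_period_subinterval[OF q(2) _ in2]]
      Q q_def q'_def r_def by simp
  have "has_period f y h r"
    using has_period_extend[OF r q(1) _ in1] r_le Q q_def q'_def by simp
  then have "q \<le> r" using least_period_le q_def by blast
  moreover have "has_period f y' h' r"
    using has_period_extend[OF r q(2) _ _ in2] r_le Q q_def q'_def by simp
  then have "q' \<le> r" using least_period_le q'_def by blast
  ultimately have "q = q'" using r_le by simp
  then have "f (y' - 1) = f (y' - 1 + q')"
    using has_periodD[OF q(1), of "y' - 1"] assms(9) y' le(1) has_period_pos[OF q(1)] by simp
  then show False using s(2) by (simp add: period_start_def q'_def)
qed

section \<open>Periodic stretches and occurrences\<close>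

lemma sum_inverse_power2_le: "(\<Sum>t<n. 1 / 2 ^ t) \<le> (2::real)"
proof -
  have "(\<Sum>t<n. 1 / 2 ^ t) = (2::real) - 2 / 2 ^ n"
    by (induction n) (auto simp: field_simps)
  then show ?thesis by simp
qed

lemma sum_cover_le:
  fixes g :: "'a \<Rightarrow> real"
  assumes I: "finite I" "\<And>i. i \<in> I \<Longrightarrow> finite (A i)"
    and S: "S \<subseteq> (\<Union>i\<in>I. A i)" and nonneg: "\<And>x. 0 \<le> g x"
  shows "sum g S \<le> (\<Sum>i\<in>I. sum g (A i))"
proof -
  have "sum g S \<le> sum g (\<Union>i\<in>I. A i)"
    using I S nonneg by (intro sum_mono2) auto
  also have "\<dots> \<le> (\<Sum>i\<in>I. sum g (A i))"
    using I
  proof (induction I rule: finite_induct)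
    case (insert i I)
    have "sum g (A i \<union> (\<Union>i\<in>I. A i)) \<le> sum g (A i) + sum g (\<Union>i\<in>I. A i)"
      using insert by (subst sum_Un) (auto intro: sum_nonneg nonneg)
    then show ?case using insert by simp
  qed simp
  finally show ?thesis .
qed

lemma power2_bracket:
  assumes "1 \<le> (q::nat)"
  obtains t where "2 ^ t \<le> q" "q < 2 ^ Suc t"
  using ex_power_ivl1[of 2 q] assms by auto

text \<open>With \<open>h = 2 ^ m\<close>, each start owns the interval
  \<open>[y + h / 4, y + h / 2)\<close>. These intervals are pairwise disjoint and lie below
  \<open>N\<close>, and each has length \<open>h / 4\<close>.\<close>

lemma sum_period_starts_class:
  fixes f :: "nat \<Rightarrow> 'a"
  assumes fin: "finite S"
    and S: "\<And>m y. (m, y) \<in> S \<Longrightarrow> period_start f (2 ^ m) y \<and> y + 2 ^ m \<le> N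
        \<and> 2 ^ t \<le> least_period f y (2 ^ m) \<and> least_period f y (2 ^ m) < 2 ^ Suc t"
  shows "(\<Sum>(m, y)\<in>S. 2 ^ m) \<le> 4 * N"
proof -
  \<comment> \<open>Cutting a stretch at dyadic scales makes these intervals disjoint also for equal \<open>y\<close>.\<close>
  define J where "J = (\<lambda>(m, y). {y + 2 ^ m div 4..<y + 2 ^ m div (2::nat)})"
  \<comment> \<open>A period of at least 1 forces \<open>2 ^ m \<ge> 8\<close>, so the division by 4
    is exact.\<close>
  have h: "\<exists>h. (2::nat) ^ m = 4 * h \<and> 0 < h" if "(m, y) \<in> S" for m y
  proof -
    have "8 * least_period f y (2 ^ m) \<le> 2 ^ m" "1 \<le> least_period f y (2 ^ m)"
      using S[OF that] least_period_pos[of "2 ^ m" f y] by (auto simp: period_start_def)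
    then have "(2::nat) ^ 3 \<le> 2 ^ m" by simp
    then have "3 \<le> m" using power_le_imp_le_exp[of "2::nat" 3 m] by simp
    then obtain i where "m = 2 + i" using le_Suc_ex[of 2 m] by auto
    then show ?thesis by (intro exI[of _ "2 ^ i"]) simp
  qed
  have sep: "J (m, y) \<inter> J (m', y') = {}"
    if "(m, y) \<in> S" "(m', y') \<in> S" "y < y'" for m y m' y'
    using period_start_gap[of f "2 ^ m" y "2 ^ m'" y' "2 ^ t"] S[OF that(1)] S[OF that(2)] that(3)
    by (auto simp: J_def)
  have same: "J (m, y) \<inter> J (m', y) = {}" if "m < m'" "(m', y) \<in> S" for m m' y
  proof -
    have "(2::nat) ^ Suc m \<le> 2 ^ m'" using that by (intro power_increasing) auto
    then have "(2::nat) ^ m div 2 \<le> 2 ^ m' div 4" using h[OF that(2)] by auto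
    then show ?thesis by (auto simp: J_def)
  qed
  have disj: "J a \<inter> J b = {}" if ab: "a \<in> S" "b \<in> S" "a \<noteq> b" for a b
  proof -
    obtain m y m' y' where e: "a = (m, y)" "b = (m', y')" by fastforce
    consider "y < y'" | "y' < y" | "y = y'" "m < m'" | "y = y'" "m' < m"
      using ab(3) e by (metis linorder_neqE_nat)
    then show ?thesis
      by cases (use sep same ab e in \<open>(metis Int_commute)+\<close>)
  qed
  have "(\<Sum>a\<in>S. card (J a)) = card (\<Union>a\<in>S. J a)"
    using card_UN_disjoint[OF fin, of J] disj by (simp add: J_def split: prod.splits)
  also have "\<dots> \<le> card {..<N}"
  proof (rule card_mono)
    show "(\<Union>a\<in>S. J a) \<subseteq> {..<N}"
    proof clarify
      fix m y z assume a: "(m, y) \<in> S" "z \<in> J (m, y)"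
      have "z < y + 2 ^ m div 2" "y + 2 ^ m \<le> N" using S[OF a(1)] a(2) by (auto simp: J_def)
      then show "z < N" by linarith
    qed
  qed simp
  finally have "4 * (\<Sum>a\<in>S. card (J a)) \<le> 4 * N" by simp
  moreover have "4 * (\<Sum>a\<in>S. card (J a)) = (\<Sum>(m, y)\<in>S. 2 ^ m)"
    unfolding sum_distrib_left
  proof (rule sum.cong[OF refl])
    fix a assume a: "a \<in> S"
    obtain m y where e: "a = (m, y)" by fastforce
    obtain h where "(2::nat) ^ m = 4 * h" using h a e by blast
    then show "4 * card (J a) = (case a of (m, y) \<Rightarrow> 2 ^ m)"
      using e by (simp add: J_def)
  qed
  ultimately show ?thesis by simp
qed

text \<open>Starts with periods in \<open>[2 ^ t, 2 ^ Suc t)\<close> contribute at most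
  \<open>4 * N / 2 ^ t\<close> over all scales together. The geometric series makes the bound
  independent of \<open>M\<close>.\<close>

lemma sum_period_starts:
  fixes f :: "nat \<Rightarrow> 'a"
  shows "(\<Sum>m<M. \<Sum>y | period_start f (2 ^ m) y \<and> y + 2 ^ m \<le> N.
            2 ^ m / real (least_period f y (2 ^ m))) \<le> 8 * real N"
proof -
  define Y where "Y = (\<lambda>m. {y. period_start f (2 ^ m) y \<and> y + 2 ^ m \<le> N})"
  define S where "S = (SIGMA m:{..<M}. Y m)"
  define g where "g = (\<lambda>(m, y). 2 ^ m / real (least_period f y (2 ^ m)))"
  define lev where "lev = (\<lambda>t. {(m, y) \<in> S. 2 ^ t \<le> least_period f y (2 ^ m) \<and> least_period f y (2 ^ m) < 2 ^ Suc t})"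
  have finY: "finite (Y m)" for m by (rule finite_subset[of _ "{..N}"]) (auto simp: Y_def)
  then have finS: "finite S" by (auto simp: S_def)
  have gnn: "0 \<le> g a" for a by (auto simp: g_def split: prod.splits)
  have cover: "S \<subseteq> (\<Union>t<M. lev t)"
  proof clarify
    fix m y assume a: "(m, y) \<in> S"
    have "1 \<le> least_period f y (2 ^ m)" using least_period_pos[of "2 ^ m" f y] by simp
    then obtain t where t: "2 ^ t \<le> least_period f y (2 ^ m)" "least_period f y (2 ^ m) < 2 ^ Suc t"
      by (rule power2_bracket)
    have "(2::nat) ^ t \<le> 2 ^ m" using t(1) least_period_le_length[of "2 ^ m" f y] by (meson le_trans pos2 zero_less_power)
    then have "t \<le> m" by (rule power_le_imp_le_exp[rotated]) simp
    then show "(m, y) \<in> (\<Union>t<M. lev t)" using a t by (auto simp: lev_def S_def)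
  qed
  have lev: "sum g (lev t) \<le> 4 * real N * (1 / 2 ^ t)" for t
  proof -
    have "sum g (lev t) \<le> (\<Sum>(m, y)\<in>lev t. 2 ^ m / 2 ^ t)"
    proof (rule sum_mono, clarify)
      fix m y assume "(m, y) \<in> lev t"
      then have "(2::nat) ^ t \<le> least_period f y (2 ^ m)" by (auto simp: lev_def)
      then have "(2::real) ^ t \<le> real (least_period f y (2 ^ m))"
        by (metis of_nat_le_iff of_nat_numeral of_nat_power)
      then show "g (m, y) \<le> 2 ^ m / 2 ^ t" by (simp add: g_def frac_le)
    qed
    also have "\<dots> = real (\<Sum>(m, y)\<in>lev t. 2 ^ m) / 2 ^ t"
      by (simp add: sum_divide_distrib case_prod_unfold)
    also have "\<dots> \<le> real (4 * N) / 2 ^ t"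
    proof (rule divide_right_mono)
      have "finite (lev t)" using finS by (rule finite_subset[rotated]) (auto simp: lev_def)
      then have "(\<Sum>(m, y)\<in>lev t. 2 ^ m) \<le> 4 * N"
        by (rule sum_period_starts_class[where t = t]) (auto simp: lev_def S_def Y_def)
      then show "real (\<Sum>(m, y)\<in>lev t. 2 ^ m) \<le> real (4 * N)" by (simp only: of_nat_le_iff)
    qed simp
    finally show ?thesis by simp
  qed
  have "sum g S \<le> (\<Sum>t<M. sum g (lev t))"
    by (rule sum_cover_le[OF _ _ cover]) (use finS gnn in \<open>auto simp: lev_def intro: finite_subset[of _ S]\<close>)
  also have "\<dots> \<le> (\<Sum>t<M. 4 * real N * (1 / 2 ^ t))" by (rule sum_mono) (rule lev)
  also have "\<dots> = 4 * real N * (\<Sum>t<M. 1 / 2 ^ t)" by (simp only: sum_distrib_left)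
  also have "\<dots> \<le> 4 * real N * 2" by (intro mult_left_mono sum_inverse_power2_le) simp
  finally have "sum g S \<le> 8 * real N" by simp
  moreover have "sum g S = (\<Sum>m<M. \<Sum>y\<in>Y m. g (m, y))"
    unfolding S_def by (subst sum.Sigma) (use finY in auto)
  ultimately show ?thesis by (simp add: g_def Y_def)
qed

section \<open>Occurrences of a block and their separation\<close>

lemma card_separated_le:
  fixes A :: "nat set"
  assumes "A \<subseteq> {u..<u + P}" and sep: "\<And>z z'. z \<in> A \<Longrightarrow> z' \<in> A \<Longrightarrow> z < z' \<Longrightarrow> z + q \<le> z'"
  shows "card A * q \<le> P + q"
proof -
  have fin: "finite A" using assms(1) finite_subset by blast
  have disj: "{a..<a + q} \<inter> {b..<b + q} = {}" if "a \<in> A" "b \<in> A" "a \<noteq> b" for a b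
    using sep[of a b] sep[of b a] that by (cases "a < b") auto
  have "card A * q = card (\<Union>z\<in>A. {z..<z + q})"
    using card_UN_disjoint[OF fin, of "\<lambda>z. {z..<z + q}"] disj by simp
  also have "\<dots> \<le> card {u..<u + P + q}"
    by (rule card_mono) (use assms(1) in \<open>fastforce+\<close>)
  finally show ?thesis by simp
qed

definition occurs_at :: "(nat \<Rightarrow> 'a) \<Rightarrow> nat \<Rightarrow> nat \<Rightarrow> nat \<Rightarrow> bool" where
  "occurs_at f x h z \<longleftrightarrow> (\<forall>t<h. f (z + t) = f (x + t))"

text \<open>If two occurrences overlap, their distance is a period of the block; otherwise it is at
  least \<open>h\<close>, which bounds the least period.\<close>

lemma occurs_at_separated:
  assumes "occurs_at f x h z" "occurs_at f x h z'" "z < z'" "0 < h"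
  shows "z + least_period f x h \<le> z'"
proof (cases "z' - z < h")
  case True
  have "has_period f x h (z' - z)"
    unfolding has_period_def
  proof (intro conjI allI impI)
    show "0 < z' - z" using assms by simp
    fix j assume j: "x \<le> j \<and> j + (z' - z) < x + h"
    define t where "t = j - x"
    have t: "j = x + t" "t < h" "t + (z' - z) < h" using j t_def by auto
    have "f (x + t) = f (z' + t)" using assms(2) t by (simp add: occurs_at_def)
    also have "\<dots> = f (z + (t + (z' - z)))" using assms(3) by (simp add: algebra_simps)
    also have "\<dots> = f (x + (t + (z' - z)))" using assms(1) t by (simp only: occurs_at_def)
    finally show "f j = f (j + (z' - z))" using t(1) by (simp add: add.assoc)
  qed
  then have "least_period f x h \<le> z' - z" by (rule least_period_le)
  then show ?thesis using assms(3) by simp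
next
  case False
  then show ?thesis using least_period_le_length[OF assms(4), of f x] assms(3) by linarith
qed

lemma has_period_occurrence:
  assumes "occurs_at f x h z" "has_period f x h r"
  shows "has_period f z h r"
  unfolding has_period_def
proof (intro conjI allI impI)
  show "0 < r" using assms(2) has_period_pos by blast
  fix j assume j: "z \<le> j \<and> j + r < z + h"
  define t where "t = j - z"
  have t: "j = z + t" "t + r < h" "t < h" using j t_def by auto
  have "f (z + t) = f (x + t)" using assms(1) t by (simp add: occurs_at_def)
  also have "\<dots> = f (x + t + r)" using has_periodD[OF assms(2), of "x + t"] t by simp
  also have "\<dots> = f (z + (t + r))" using assms(1) t unfolding occurs_at_def by (metis add.assoc)
  finally show "f j = f (j + r)" using t by (simp add: add.assoc)
qed

lemma least_period_occurrence:
  assumes "occurs_at f x h z"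
  shows "least_period f z h = least_period f x h"
proof -
  have "occurs_at f z h x" using assms by (simp add: occurs_at_def)
  then have "has_period f x h = has_period f z h"
    using has_period_occurrence[of f x h z] has_period_occurrence[of f z h x] assms by blast
  then show ?thesis by (simp add: least_period_def)
qed

text \<open>The distances at which a fixed block recurs inherit the separation of its occurrences.
  This bounds the number of periods \<open>l\<close> that one block can serve.\<close>

lemma card_shifts_right:
  assumes "0 < h"
  shows "card {l \<in> {u..<u + P}. occurs_at f x h (x + l)} * least_period f x h
    \<le> P + least_period f x h"
  by (rule card_separated_le[where u = u]) (use occurs_at_separated[OF _ _ _ assms] in fastforce)+

lemma card_shifts_left:
  assumes "0 < h"
  shows "card {l \<in> {u..<u + P}. l \<le> x \<and> occurs_at f x h (x - l)} * least_period f x h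
    \<le> P + least_period f x h"
proof (rule card_separated_le[where u = u])
  fix l l' assume "l \<in> {l \<in> {u..<u + P}. l \<le> x \<and> occurs_at f x h (x - l)}"
    "l' \<in> {l \<in> {u..<u + P}. l \<le> x \<and> occurs_at f x h (x - l)}" "l < l'"
  then show "l + least_period f x h \<le> l'"
    using occurs_at_separated[of f x h "x - l'" "x - l", OF _ _ _ assms] by force
qed auto

section \<open>Gaps between mismatches\<close>

text \<open>Twice the block length guarantees that the gap after \<open>d\<close> contains a block
  of length \<open>2 ^ m\<close> starting at a multiple of \<open>2 ^ m\<close>.\<close>

definition gap_pairs :: "(nat \<Rightarrow> 'a) \<Rightarrow> nat \<Rightarrow> nat \<Rightarrow> nat \<Rightarrow> (nat \<times> nat) set" where
  "gap_pairs f n m p = {(d, l). 1 \<le> d \<and> d + 2 * 2 ^ m \<le> n \<and> l \<le> n \<and> 2 ^ p \<le> l \<and> l < 2 * 2 ^ p \<and>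
     f d \<noteq> f (d + l) \<and> (\<forall>j. d < j \<and> j < d + 2 * 2 ^ m \<longrightarrow> f j = f (j + l))}"

lemma finite_gap_pairs: "finite (gap_pairs f n m p)"
  by (rule finite_subset[of _ "{..n} \<times> {..n}"]) (auto simp: gap_pairs_def)

text \<open>The later of two distinct starts would be a mismatch strictly inside the gap of the
  earlier one.\<close>

lemma gap_pairs_unique:
  assumes "(d, l) \<in> gap_pairs f n m p" "(d', l) \<in> gap_pairs f n m p"
    and "d < z" "z < d + 2 * 2 ^ m" "d' < z" "z < d' + 2 * 2 ^ m"
  shows "d = d'"
proof (rule ccontr)
  assume "d \<noteq> d'"
  moreover have "\<not> d < d'" "\<not> d' < d" using assms by (force simp: gap_pairs_def)+
  ultimately show False by simp
qed

text \<open>A point inside the gap determines the gap for given \<open>l\<close>, so every element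
  of \<open>R\<close> pays for at most one. The map \<open>\<phi>\<close> allows a point of the copy
  to be moved back by \<open>l\<close>.\<close>

lemma card_gap_pairs_charge:
  assumes "finite R" "Z \<subseteq> gap_pairs f n m p"
    and "\<And>d l. (d, l) \<in> Z \<Longrightarrow> \<exists>y. (y, l) \<in> R \<and> d < \<phi> y l \<and> \<phi> y l < d + 2 * 2 ^ m"
  shows "card Z \<le> card R"
proof (rule card_le_if_inj_on_rel[where
      r = "\<lambda>(d, l) (y, l'). l = l' \<and> d < \<phi> y l \<and> \<phi> y l < d + 2 * 2 ^ m"])
  show "finite R" by fact
next
  fix a assume "a \<in> Z"
  then show "\<exists>b. b \<in> R \<and> (case a of (d, l) \<Rightarrow> \<lambda>(y, l'). l = l' \<and> d < \<phi> y l \<and> \<phi> y l < d + 2 * 2 ^ m) b"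
    using assms(3)[of "fst a" "snd a"] by (cases a) fastforce
next
  fix a1 a2 b
  assume "a1 \<in> Z" "a2 \<in> Z"
    "(case a1 of (d, l) \<Rightarrow> \<lambda>(y, l'). l = l' \<and> d < \<phi> y l \<and> \<phi> y l < d + 2 * 2 ^ m) b"
    "(case a2 of (d, l) \<Rightarrow> \<lambda>(y, l'). l = l' \<and> d < \<phi> y l \<and> \<phi> y l < d + 2 * 2 ^ m) b"
  then show "a1 = a2"
    using gap_pairs_unique[of "fst a1" "snd a1" f n m p "fst a2" "\<phi> (fst b) (snd b)"] assms(2)
    by (cases a1; cases a2; cases b) auto
qed

text \<open>Every gap is charged to a pair with the same \<open>l\<close>: in \<open>R1\<close> to
  an aligned block of least period above \<open>h / 8\<close>, in \<open>R2\<close> to a stretch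
  starting in the gap, in \<open>R3\<close> to one starting in its copy. Each block or start serves
  at most \<open>2 * P / lp\<close> values of \<open>l\<close>.\<close>

lemma card_gap_pairs_le:
  fixes f :: "nat \<Rightarrow> 'a"
  assumes "m \<le> p"
  shows "real (card (gap_pairs f n m p)) * 2 ^ m / 2 ^ p \<le> 16 * real n / 2 ^ m +
    4 * (\<Sum>y | period_start f (2 ^ m) y \<and> y + 2 ^ m \<le> 2 * n. 2 ^ m / real (least_period f y (2 ^ m)))"
proof -
  define h :: nat where "h = 2 ^ m"
  define P :: nat where "P = 2 ^ p"
  have hP: "0 < h" "h \<le> P" using assms by (auto simp: h_def P_def intro: power_increasing)
  define Z where "Z = gap_pairs f n m p"
  \<comment> \<open>The copy of a gap may reach beyond \<open>n\<close>, but with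
    \<open>d + 2 * h \<le> n\<close> and \<open>l \<le> n\<close> it ends by
    \<open>2 * n\<close>.\<close>
  define Y where "Y = {y. period_start f h y \<and> y + h \<le> 2 * n}"
  define X where "X = {x \<in> {1..n}. h dvd x}"
  define lp where "lp = (\<lambda>y. least_period f y h)"
  define A1 where "A1 = (\<lambda>x. {l \<in> {P..<P + P}. occurs_at f x h (x + l)})"
  define A2 where "A2 = (\<lambda>x. {l \<in> {P..<P + P}. l \<le> x \<and> occurs_at f x h (x - l)})"
  define R1 where "R1 = (SIGMA x:{x \<in> X. h < 8 * lp x}. A1 x)"
  define R2 where "R2 = (SIGMA y:Y. A1 y)"
  define R3 where "R3 = (SIGMA y:Y. A2 y)"
  have finY: "finite Y" by (rule finite_subset[of _ "{..2 * n}"]) (auto simp: Y_def)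
  have finX: "finite X" by (auto simp: X_def)
  have finA: "finite (A1 x)" "finite (A2 x)" for x by (auto simp: A1_def A2_def)
  have fin: "finite R1" "finite R2" "finite R3" using finX finY finA by (auto simp: R1_def R2_def R3_def)
  have lp: "0 < lp y" "lp y \<le> P" for y
    using least_period_pos[OF hP(1), of f y] least_period_le_length[OF hP(1), of f y] hP(2)
    by (auto simp: lp_def)
  \<comment> \<open>Since \<open>lp y \<le> h \<le> P\<close>, the additive term of the shift count
    is absorbed by a second \<open>P\<close>.\<close>
  have cA: "card (A1 y) * lp y \<le> 2 * P" "card (A2 y) * lp y \<le> 2 * P" for y
    using card_shifts_right[OF hP(1), of P P f y] card_shifts_left[OF hP(1), of P P y f] lp[of y]
    by (auto simp: A1_def A2_def lp_def)
  have cA': "real (card (A1 y)) \<le> 2 * real P / real (lp y)" "real (card (A2 y)) \<le> 2 * real P / real (lp y)" for y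
  proof -
    have "real (card (A1 y) * lp y) \<le> real (2 * P)" "real (card (A2 y) * lp y) \<le> real (2 * P)"
      using cA[of y] by (simp_all only: of_nat_le_iff)
    then show "real (card (A1 y)) \<le> 2 * real P / real (lp y)" "real (card (A2 y)) \<le> 2 * real P / real (lp y)"
      using lp[of y] by (simp_all add: field_simps)
  qed
  have c1: "real (card R1) \<le> (real n / real h) * (16 * real P / real h)"
  proof -
    have "real (card R1) = (\<Sum>x\<in>{x \<in> X. h < 8 * lp x}. real (card (A1 x)))"
      unfolding R1_def using finX finA by (subst card_SigmaI) auto
    also have "\<dots> \<le> (\<Sum>x\<in>{x \<in> X. h < 8 * lp x}. 16 * real P / real h)"
    proof (rule sum_mono)
      fix x assume "x \<in> {x \<in> X. h < 8 * lp x}"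
      then have "card (A1 x) * h \<le> card (A1 x) * (8 * lp x)" by simp
      also have "\<dots> \<le> 16 * P" using cA(1)[of x] by (simp add: mult.commute)
      finally have "real (card (A1 x) * h) \<le> real (16 * P)" by (simp only: of_nat_le_iff)
      then show "real (card (A1 x)) \<le> 16 * real P / real h" using hP(1) by (simp add: field_simps)
    qed
    also have "\<dots> \<le> (\<Sum>x\<in>X. 16 * real P / real h)" by (rule sum_mono2) (use finX in auto)
    also have "\<dots> = real (card X) * (16 * real P / real h)" by simp
    also have "\<dots> \<le> (real n / real h) * (16 * real P / real h)"
    proof (rule mult_right_mono)
      have "X \<subseteq> (\<lambda>i. i * h) ` {1..n div h}"
      proof
        fix x assume "x \<in> X"
        then obtain i where i: "x = i * h" "1 \<le> x" "x \<le> n" by (auto simp: X_def dvd_def mult.commute)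
        then have "i \<le> n div h" using hP(1) by (simp add: less_eq_div_iff_mult_less_eq)
        moreover have "1 \<le> i" using i by (cases i) auto
        ultimately show "x \<in> (\<lambda>i. i * h) ` {1..n div h}" using i by auto
      qed
      then have "card X \<le> n div h" using surj_card_le[of "{1..n div h}" X] by simp
      then have "card X * h \<le> n" using hP(1) by (simp add: less_eq_div_iff_mult_less_eq)
      then have "real (card X * h) \<le> n" by (simp only: of_nat_le_iff)
      then show "real (card X) \<le> real n / real h" using hP(1) by (simp add: field_simps)
    qed simp
    finally show ?thesis .
  qed
  have c2: "real (card R2) \<le> (\<Sum>y\<in>Y. 2 * real P / real (lp y))"
    unfolding R2_def using finY finA by (subst card_SigmaI) (auto intro!: sum_mono cA')
  have c3: "real (card R3) \<le> (\<Sum>y\<in>Y. 2 * real P / real (lp y))"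
    unfolding R3_def using finY finA by (subst card_SigmaI) (auto intro!: sum_mono cA')
  define Z1 where "Z1 = {(d, l) \<in> Z. \<exists>y. (y, l) \<in> R1 \<and> d < y \<and> y < d + 2 * 2 ^ m}"
  define Z2 where "Z2 = {(d, l) \<in> Z. \<exists>y. (y, l) \<in> R2 \<and> d < y \<and> y < d + 2 * 2 ^ m}"
  define Z3 where "Z3 = {(d, l) \<in> Z. \<exists>y. (y, l) \<in> R3 \<and> d < y - l \<and> y - l < d + 2 * 2 ^ m}"
  have card_Z: "card Z1 \<le> card R1" "card Z2 \<le> card R2" "card Z3 \<le> card R3"
    by (rule card_gap_pairs_charge[where \<phi> = "\<lambda>y l. y" and f = f and n = n and m = m and p = p]
        card_gap_pairs_charge[where \<phi> = "\<lambda>y l. y - l" and f = f and n = n and m = m and p = p];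
        use fin in \<open>auto simp: Z1_def Z2_def Z3_def Z_def\<close>)+
  have "Z \<subseteq> Z1 \<union> Z2 \<union> Z3"
  proof clarify
    fix d l assume dl: "(d, l) \<in> Z" and n3: "(d, l) \<notin> Z3" and n2: "(d, l) \<notin> Z2"
    have d: "1 \<le> d" "d + 2 * h \<le> n" "l \<le> n" "P \<le> l" "l < 2 * P" "f d \<noteq> f (d + l)"
      and eq: "\<And>j. d < j \<Longrightarrow> j < d + 2 * h \<Longrightarrow> f j = f (j + l)"
      using dl by (auto simp: Z_def gap_pairs_def h_def P_def)
    \<comment> \<open>The first multiple of \<open>h\<close> after \<open>d\<close>; its block ends
      by \<open>d + 2 * h\<close>.\<close>
    define x where "x = h * (d div h + 1)"
    have x: "h dvd x" "d < x" "x \<le> d + h"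
    proof -
      show "h dvd x" by (simp add: x_def)
      have "h * (d div h) + d mod h = d" by simp
      moreover have "d mod h < h" using hP(1) by simp
      ultimately show "d < x" "x \<le> d + h" unfolding x_def distrib_left by linarith+
    qed
    have occ: "occurs_at f y h (y + l)" if "d < y" "y \<le> x" for y
      using eq[of "y + t" for t] that x by (auto simp: occurs_at_def add.assoc add.commute add.left_commute)
    have occ': "occurs_at f (y + l) h y" if "d < y" "y \<le> x" for y
      using occ[OF that] by (simp add: occurs_at_def)
    show "(d, l) \<in> Z1"
    proof (rule ccontr)
      assume n1: "(d, l) \<notin> Z1"
      define q where "q = lp x"
      have q8: "8 * q \<le> h"
      proof (rule ccontr)
        assume "\<not> 8 * q \<le> h"
        then have "(x, l) \<in> R1" using x d occ[of x] by (auto simp: R1_def X_def A1_def q_def)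
        then show False using n1 dl x hP by (auto simp: Z1_def h_def[symmetric])
      qed
      have q: "0 < q" using lp q_def by simp
      have q': "q = least_period f (x + l) h"
        using least_period_occurrence[OF occ[of x]] x by (simp add: q_def lp_def)
      have left: "f d = f (d + q)"
      proof (rule ccontr)
        assume "f d \<noteq> f (d + q)"
        then obtain y where y: "d < y" "y \<le> x" "period_start f h y"
          using period_start_exists[OF hP(1), of q f x d] q_def lp_def q8 x by auto
        then have "(y, l) \<in> R2" using x d occ[of y] by (auto simp: R2_def Y_def A1_def)
        then show False using n2 dl x hP y by (auto simp: Z2_def h_def[symmetric])
      qed
      have right: "f (d + l) = f (d + l + q)"
      proof (rule ccontr)
        assume "f (d + l) \<noteq> f (d + l + q)"
        then obtain y where y: "d + l < y" "y \<le> x + l" "period_start f h y"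
          using period_start_exists[OF hP(1) q' q8, of "d + l"] x by auto
        then have "(y, l) \<in> R3" using x d occ'[of "y - l"] by (auto simp: R3_def Y_def A2_def)
        moreover have "d < y - l" "y - l < d + 2 * h" using x y hP(1) by linarith+
        ultimately show False using n3 dl by (auto simp: Z3_def h_def[symmetric])
      qed
      \<comment> \<open>As \<open>d + q\<close> is inside the gap, \<open>left\<close> and
        \<open>right\<close> would turn the mismatch at \<open>d\<close> into a match.\<close>
      have "f (d + q) = f (d + q + l)" using eq[of "d + q"] q q8 by simp
      then show False using left right d(6) by (simp add: add.commute add.left_commute)
    qed
  qed
  then have "card Z \<le> card (Z1 \<union> Z2 \<union> Z3)"
    by (rule card_mono[rotated]) (use finite_gap_pairs[of f n m p] in
        \<open>auto simp: Z1_def Z2_def Z3_def Z_def intro: finite_subset\<close>)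
  also have "\<dots> \<le> card Z1 + card Z2 + card Z3"
    using card_Un_le[of "Z1 \<union> Z2" Z3] card_Un_le[of Z1 Z2] by linarith
  finally have "real (card Z) \<le> (real n / real h) * (16 * real P / real h) + 2 * (\<Sum>y\<in>Y. 2 * real P / real (lp y))"
    using card_Z c1 c2 c3 by linarith
  then have "real (card Z) * (real h / real P) \<le> ((real n / real h) * (16 * real P / real h) + 2 * (\<Sum>y\<in>Y. 2 * real P / real (lp y))) * (real h / real P)"
    by (rule mult_right_mono) simp
  also have "\<dots> = 16 * real n / real h + 4 * (\<Sum>y\<in>Y. real h / real (lp y))"
  proof -
    have "(real n / real h) * (16 * real P / real h) * (real h / real P) = 16 * real n / real h" using hP by simp
    moreover have "2 * (\<Sum>y\<in>Y. 2 * real P / real (lp y)) * (real h / real P) = 4 * (\<Sum>y\<in>Y. real h / real (lp y))"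
      unfolding sum_distrib_left sum_distrib_right
      by (rule sum.cong) (use hP in \<open>auto simp: field_simps\<close>)
    ultimately show ?thesis by (simp only: distrib_right)
  qed
  finally show ?thesis by (simp add: Z_def h_def P_def Y_def lp_def)
qed

text \<open>The bound for one class does not depend on \<open>p\<close>, so the \<open>w\<close>
  values of \<open>p\<close> cost a factor \<open>w\<close>. Summing over \<open>m\<close> gives
  \<open>32 * n\<close> from the aligned blocks and \<open>64 * n\<close> from the starts below
  \<open>2 * n\<close>.\<close>

lemma sum_card_gap_pairs_le:
  fixes f :: "nat \<Rightarrow> 'a"
  shows "(\<Sum>m<M. \<Sum>p\<in>{m + 1..m + w}. real (card (gap_pairs f n m p)) * 2 ^ m / 2 ^ p) \<le> 96 * real w * real n"
proof -
  define B where "B = (\<lambda>m. 16 * real n / 2 ^ m +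
    4 * (\<Sum>y | period_start f (2 ^ m) y \<and> y + 2 ^ m \<le> 2 * n. 2 ^ m / real (least_period f y (2 ^ m))))"
  have "(\<Sum>m<M. \<Sum>p\<in>{m + 1..m + w}. real (card (gap_pairs f n m p)) * 2 ^ m / 2 ^ p)
    \<le> (\<Sum>m<M. \<Sum>p\<in>{m + 1..m + w}. B m)"
    unfolding B_def by (intro sum_mono card_gap_pairs_le) auto
  also have "\<dots> = real w * (\<Sum>m<M. B m)" by (simp add: sum_distrib_left)
  also have "\<dots> \<le> real w * (96 * real n)"
  proof (rule mult_left_mono)
    have "(\<Sum>m<M. B m) = 16 * real n * (\<Sum>m<M. 1 / 2 ^ m) + 4 * (\<Sum>m<M. \<Sum>y | period_start f (2 ^ m) y
        \<and> y + 2 ^ m \<le> 2 * n. 2 ^ m / real (least_period f y (2 ^ m)))"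
      unfolding B_def sum.distrib sum_distrib_left by simp
    also have "\<dots> \<le> 16 * real n * 2 + 4 * (8 * real (2 * n))"
      by (intro add_mono mult_left_mono sum_inverse_power2_le sum_period_starts) auto
    finally show "(\<Sum>m<M. B m) \<le> 96 * real n" by simp
  qed simp
  finally show ?thesis by (simp add: mult.commute mult.left_commute)
qed

section \<open>Windows starting with a mismatch\<close>

text \<open>The truncation at \<open>l\<close> keeps the weight \<open>gap f l d / l\<close> of a long exact repetition at most 1.\<close>

definition gap :: "(nat \<Rightarrow> 'a) \<Rightarrow> nat \<Rightarrow> nat \<Rightarrow> nat" where
  "gap f l d = (LEAST g. 1 \<le> g \<and> (f (d + g) \<noteq> f (d + g + l) \<or> g = l))"

lemma gap_props:
  assumes "1 \<le> l"
  shows gap_pos: "1 \<le> gap f l d" and gap_le: "gap f l d \<le> l"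
    and gap_end: "f (d + gap f l d) \<noteq> f (d + gap f l d + l) \<or> gap f l d = l"
    and gap_match: "d < j \<Longrightarrow> j < d + gap f l d \<Longrightarrow> f j = f (j + l)"
proof -
  let ?P = "\<lambda>g. 1 \<le> g \<and> (f (d + g) \<noteq> f (d + g + l) \<or> g = l)"
  have P: "?P l" using assms by simp
  show "1 \<le> gap f l d" "f (d + gap f l d) \<noteq> f (d + gap f l d + l) \<or> gap f l d = l"
    using LeastI[of ?P, OF P] unfolding gap_def by blast+
  show "gap f l d \<le> l" using Least_le[of ?P, OF P] unfolding gap_def .
  show "f j = f (j + l)" if j: "d < j" "j < d + gap f l d"
  proof -
    have "\<not> ?P (j - d)" using not_less_Least[of "j - d" ?P] j unfolding gap_def by simp
    then show ?thesis using j by auto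
  qed
qed

text \<open>The bound is \<open>n\<close> instead of \<open>n + 1\<close> because the run ends
  before the end of the string, so that position \<open>i + 2 * l\<close> exists.\<close>

definition mismatch_squares :: "(nat \<Rightarrow> 'a) \<Rightarrow> nat \<Rightarrow> nat \<Rightarrow> (nat \<times> nat) set" where
  "mismatch_squares f n k = {(i, l). 1 \<le> l \<and> 1 \<le> i \<and> i + 2 * l \<le> n \<and> f i \<noteq> f (i + l) \<and>
     card {j \<in> {i..<i + l}. f j \<noteq> f (j + l)} \<le> k}"

lemma finite_mismatch_squares: "finite (mismatch_squares f n k)"
  by (rule finite_subset[of _ "{..n} \<times> {..n}"]) (auto simp: mismatch_squares_def)

text \<open>As \<open>i\<close> is a mismatch, each position of the window has a last mismatch
  \<open>d\<close> at or before it and lies in \<open>[d, d + gap f l d)\<close>.\<close>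

lemma sum_gaps_ge:
  assumes "1 \<le> l" "f i \<noteq> f (i + l)"
  shows "l \<le> (\<Sum>d | d \<in> {i..<i + l} \<and> f d \<noteq> f (d + l). gap f l d)"
proof -
  define W where "W = {d. d \<in> {i..<i + l} \<and> f d \<noteq> f (d + l)}"
  have fin: "finite W" by (rule finite_subset[of _ "{i..<i + l}"]) (auto simp: W_def)
  have "{i..<i + l} \<subseteq> (\<Union>d\<in>W. {d..<d + gap f l d})"
  proof
    fix j assume j: "j \<in> {i..<i + l}"
    define d where "d = Max {d \<in> W. d \<le> j}"
    have "i \<in> {d \<in> W. d \<le> j}" using j assms by (auto simp: W_def)
    then have d: "d \<in> W" "d \<le> j" and mx: "\<And>e. e \<in> W \<Longrightarrow> e \<le> j \<Longrightarrow> e \<le> d"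
      using Max_in[of "{d \<in> W. d \<le> j}"] Max_ge[of "{d \<in> W. d \<le> j}"] fin unfolding d_def by fastforce+
    have "j < d + gap f l d"
    proof (rule ccontr)
      assume n: "\<not> j < d + gap f l d"
      have "gap f l d \<noteq> l" using n j d by (auto simp: W_def)
      then have "d + gap f l d \<in> W" using gap_end[OF assms(1), of f d] n j d by (auto simp: W_def)
      then show False using mx[of "d + gap f l d"] n gap_pos[OF assms(1), of f d] by simp
    qed
    then show "j \<in> (\<Union>d\<in>W. {d..<d + gap f l d})" using d by auto
  qed
  then have "card {i..<i + l} \<le> card (\<Union>d\<in>W. {d..<d + gap f l d})"
    by (rule card_mono[rotated]) (use fin in auto)
  also have "\<dots> \<le> (\<Sum>d\<in>W. card {d..<d + gap f l d})" by (rule card_UN_le[OF fin])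
  finally show ?thesis by (simp add: W_def)
qed

text \<open>At most \<open>k\<close> gaps are shorter than \<open>l / (2 k)\<close>; together they
  cover at most half of the window. The factor 2 normalizes the other half to 1.\<close>

lemma heavy_gaps:
  assumes "(i, l) \<in> mismatch_squares f n k" "1 \<le> k"
  shows "1 \<le> (\<Sum>d | d \<in> {i..<i + l} \<and> f d \<noteq> f (d + l) \<and> l \<le> 2 * k * gap f l d. 2 * (real (gap f l d) / real l))"
proof -
  define W where "W = {d. d \<in> {i..<i + l} \<and> f d \<noteq> f (d + l)}"
  define H where "H = {d \<in> W. l \<le> 2 * k * gap f l d}"
  define L where "L = {d \<in> W. \<not> l \<le> 2 * k * gap f l d}"
  have D: "1 \<le> l" "f i \<noteq> f (i + l)" "card W \<le> k"
    using assms by (auto simp: mismatch_squares_def W_def)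
  have fin: "finite W" by (rule finite_subset[of _ "{i..<i + l}"]) (auto simp: W_def)
  have WHL: "W = H \<union> L" "H \<inter> L = {}" by (auto simp: H_def L_def)
  have "real l \<le> real (\<Sum>d\<in>W. gap f l d)"
    using sum_gaps_ge[OF D(1,2)] by (simp only: of_nat_le_iff W_def)
  also have "\<dots> = (\<Sum>d\<in>H. real (gap f l d)) + (\<Sum>d\<in>L. real (gap f l d))"
    using fin WHL by (subst WHL(1), subst sum.union_disjoint) auto
  finally have 1: "real l \<le> (\<Sum>d\<in>H. real (gap f l d)) + (\<Sum>d\<in>L. real (gap f l d))" .
  have "(\<Sum>d\<in>L. real (gap f l d)) \<le> (\<Sum>d\<in>L. real l / (2 * real k))"
  proof (rule sum_mono)
    fix d assume "d \<in> L"
    then have "2 * k * gap f l d \<le> l" by (auto simp: L_def)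
    then have "real (2 * k * gap f l d) \<le> real l" by (simp only: of_nat_le_iff)
    then show "real (gap f l d) \<le> real l / (2 * real k)" using assms(2) by (simp add: field_simps)
  qed
  also have "\<dots> = real (card L) * (real l / (2 * real k))" by simp
  also have "\<dots> \<le> real k * (real l / (2 * real k))"
  proof (rule mult_right_mono)
    have "card L \<le> card W" using fin by (intro card_mono) (auto simp: L_def)
    then show "real (card L) \<le> real k" using D(3) by simp
  qed simp
  also have "\<dots> = real l / 2" using assms(2) by simp
  finally have "real l / 2 \<le> (\<Sum>d\<in>H. real (gap f l d))" using 1 by simp
  then have "1 \<le> 2 * ((\<Sum>d\<in>H. real (gap f l d)) / real l)" using D(1) by (simp add: field_simps)
  also have "\<dots> = (\<Sum>d\<in>H. 2 * (real (gap f l d) / real l))"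
    by (simp add: sum_distrib_left sum_divide_distrib)
  finally show ?thesis by (simp add: H_def W_def conj_assoc)
qed

section \<open>Double counting of windows and long gaps\<close>

text \<open>With \<open>2 * k < l\<close> every gap counted here has length at least 2 and so fits
  some class \<open>gap_pairs\<close>. Smaller periods are counted trivially.\<close>

definition heavy_pairs :: "(nat \<Rightarrow> 'a) \<Rightarrow> nat \<Rightarrow> nat \<Rightarrow> (nat \<times> nat) set" where
  "heavy_pairs f n k = {(d, l). 2 * k < l \<and> l \<le> n \<and> 1 \<le> d \<and> d + gap f l d \<le> n \<and>
     l \<le> 2 * k * gap f l d \<and> f d \<noteq> f (d + l)}"

lemma finite_heavy_pairs: "finite (heavy_pairs f n k)"
  by (rule finite_subset[of _ "{..n} \<times> {..n}"]) (auto simp: heavy_pairs_def)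

text \<open>All starts of such windows are mismatches in the leftmost of these windows, which has at
  most \<open>k\<close>.\<close>

lemma card_squares_around_le:
  "card {a \<in> mismatch_squares f n k. snd a = l \<and> fst a \<le> d \<and> d < fst a + l} \<le> k"
proof -
  define A where "A = {i. (i, l) \<in> mismatch_squares f n k \<and> i \<le> d \<and> d < i + l}"
  have fin: "finite A" by (rule finite_subset[of _ "{..d}"]) (auto simp: A_def)
  have "{a \<in> mismatch_squares f n k. snd a = l \<and> fst a \<le> d \<and> d < fst a + l} = (\<lambda>i. (i, l)) ` A"
    by (auto simp: A_def)
  then have "card {a \<in> mismatch_squares f n k. snd a = l \<and> fst a \<le> d \<and> d < fst a + l} = card A"
    by (simp add: card_image inj_on_def)
  also have "\<dots> \<le> k"
  proof (cases "A = {}")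
    case False
    define i where "i = Min A"
    have i: "i \<in> A" "\<And>j. j \<in> A \<Longrightarrow> i \<le> j" using fin False by (auto simp: i_def)
    have "A \<subseteq> {j \<in> {i..<i + l}. f j \<noteq> f (j + l)}"
      using i by (force simp: A_def mismatch_squares_def)
    then have "card A \<le> card {j \<in> {i..<i + l}. f j \<noteq> f (j + l)}" by (rule card_mono[rotated]) simp
    also have "\<dots> \<le> k" using i(1) by (auto simp: A_def mismatch_squares_def)
    finally show ?thesis .
  qed simp
  finally show ?thesis .
qed

text \<open>Each window receives weight at least 1 from its long gaps, and each gap lies in at most
  \<open>k\<close> windows of its period; exchanging the two sums gives the bound.\<close>

lemma card_long_squares_le:
  fixes f :: "nat \<Rightarrow> 'a"
  assumes "1 \<le> k"
  shows "real (card {a \<in> mismatch_squares f n k. 2 * k < snd a}) \<le>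
    2 * real k * (\<Sum>(d, l)\<in>heavy_pairs f n k. real (gap f l d) / real l)"
proof -
  define D where "D = {a \<in> mismatch_squares f n k. 2 * k < snd a}"
  define E where "E = heavy_pairs f n k"
  define w where "w = (\<lambda>e::nat \<times> nat. 2 * (real (gap f (snd e) (fst e)) / real (snd e)))"
  define R where "R = (\<lambda>a e::nat \<times> nat. snd a = snd e \<and> fst a \<le> fst e \<and> fst e < fst a + snd e)"
  have finD: "finite D" using finite_mismatch_squares[of f n k] by (simp add: D_def)
  have finE: "finite E" by (simp add: E_def finite_heavy_pairs)
  have wnn: "0 \<le> w e" for e by (simp add: w_def)
  have "real (card D) = (\<Sum>a\<in>D. 1)" by simp
  also have "\<dots> \<le> (\<Sum>a\<in>D. \<Sum>e | e \<in> E \<and> R a e. w e)"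
  proof (rule sum_mono)
    fix a assume a: "a \<in> D"
    obtain i l where e: "a = (i, l)" by fastforce
    have il: "(i, l) \<in> mismatch_squares f n k" "2 * k < l" using a e by (auto simp: D_def)
    have "1 \<le> (\<Sum>d | d \<in> {i..<i + l} \<and> f d \<noteq> f (d + l) \<and> l \<le> 2 * k * gap f l d. w (d, l))"
      using heavy_gaps[OF il(1) assms] by (simp add: w_def)
    also have "\<dots> = sum w ((\<lambda>d. (d, l)) ` {d. d \<in> {i..<i + l} \<and> f d \<noteq> f (d + l) \<and> l \<le> 2 * k * gap f l d})"
      by (subst sum.reindex) (auto simp: inj_on_def)
    also have "\<dots> \<le> (\<Sum>e | e \<in> E \<and> R a e. w e)"
    proof (rule sum_mono2)
      show "(\<lambda>d. (d, l)) ` {d. d \<in> {i..<i + l} \<and> f d \<noteq> f (d + l) \<and> l \<le> 2 * k * gap f l d} \<subseteq> {e. e \<in> E \<and> R a e}"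
      proof clarify
        fix d assume d: "d \<in> {i..<i + l}" "f d \<noteq> f (d + l)" "l \<le> 2 * k * gap f l d"
        have "gap f l d \<le> l" using gap_le[of l f d] il(2) by simp
        then show "(d, l) \<in> E \<and> R a (d, l)"
          using d il e by (auto simp: E_def R_def heavy_pairs_def mismatch_squares_def)
      qed
    qed (use finE wnn in auto)
    finally show "1 \<le> (\<Sum>e | e \<in> E \<and> R a e. w e)" .
  qed
  also have "\<dots> = (\<Sum>e\<in>E. \<Sum>a | a \<in> D \<and> R a e. w e)"
    by (rule sum.swap_restrict[OF finD finE])
  also have "\<dots> \<le> (\<Sum>e\<in>E. real k * w e)"
  proof (rule sum_mono)
    fix e
    have "{a. a \<in> D \<and> R a e} \<subseteq> {a \<in> mismatch_squares f n k. snd a = snd e \<and> fst a \<le> fst e \<and> fst e < fst a + snd e}"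
      by (auto simp: D_def R_def)
    then have "card {a. a \<in> D \<and> R a e} \<le> k"
      using card_squares_around_le[of f n k "snd e" "fst e"] finite_mismatch_squares[of f n k]
        card_mono[of "{a \<in> mismatch_squares f n k. snd a = snd e \<and> fst a \<le> fst e \<and> fst e < fst a + snd e}" "{a. a \<in> D \<and> R a e}"]
      by simp
    then have "real (card {a. a \<in> D \<and> R a e}) * w e \<le> real k * w e"
      by (intro mult_right_mono wnn) simp
    then show "(\<Sum>a | a \<in> D \<and> R a e. w e) \<le> real k * w e" by simp
  qed
  also have "\<dots> = 2 * real k * (\<Sum>(d, l)\<in>E. real (gap f l d) / real l)"
    by (simp add: sum_distrib_left w_def case_prod_unfold mult.assoc mult.left_commute)
  finally show ?thesis by (simp add: D_def E_def)
qed

text \<open>For a gap \<open>g\<close> with \<open>2 * 2 ^ m \<le> g < 4 * 2 ^ m\<close>,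
  \<open>g \<le> l\<close> yields \<open>m < p\<close> and \<open>l \<le> 2 * k * g\<close> yields
  \<open>p < m + \<kappa> + 3\<close>. So each \<open>m\<close> meets \<open>\<kappa> + 2\<close>
  values of \<open>p\<close>, and the weights are at most \<open>4 * 2 ^ m / 2 ^ p\<close>.\<close>

lemma sum_heavy_pairs_le:
  fixes f :: "nat \<Rightarrow> 'a"
  assumes k: "1 \<le> k" "k \<le> 2 ^ \<kappa>"
  shows "(\<Sum>(d, l)\<in>heavy_pairs f n k. real (gap f l d) / real l) \<le> 384 * real (\<kappa> + 2) * real n"
proof -
  define g where "g = (\<lambda>(d, l). real (gap f l d) / real l)"
  define I where "I = (SIGMA m:{..<n}. {m + 1..m + (\<kappa> + 2)})"
  define A where "A = (\<lambda>(m, p). {(d, l) \<in> gap_pairs f n m p. gap f l d < 4 * 2 ^ m})"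
  have finA: "finite (A i)" for i
    by (rule finite_subset[of _ "gap_pairs f n (fst i) (snd i)"])
      (auto simp: A_def finite_gap_pairs split: prod.splits)
  have cover: "heavy_pairs f n k \<subseteq> (\<Union>i\<in>I. A i)"
  proof clarify
    fix d l assume dl: "(d, l) \<in> heavy_pairs f n k"
    have h: "2 * k < l" "l \<le> n" "1 \<le> d" "d + gap f l d \<le> n" "l \<le> 2 * k * gap f l d" "f d \<noteq> f (d + l)"
      using dl by (auto simp: heavy_pairs_def)
    have l1: "1 \<le> l" using h by simp
    have "\<not> gap f l d \<le> 1"
    proof
      assume "gap f l d \<le> 1"
      then have "2 * k * gap f l d \<le> 2 * k * 1" by (intro mult_le_mono) auto
      then show False using h(1,5) by linarith
    qed
    then have "1 \<le> gap f l d div 2" by simp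
    then obtain m where "2 ^ m \<le> gap f l d div 2" "gap f l d div 2 < 2 ^ Suc m" by (rule power2_bracket)
    then have m: "2 * 2 ^ m \<le> gap f l d" "gap f l d < 4 * 2 ^ m" by auto
    obtain p where p: "2 ^ p \<le> l" "l < 2 ^ Suc p" using l1 by (rule power2_bracket)
    have "2 * 2 ^ m < (2::nat) * 2 ^ p"
      using m(1) gap_le[OF l1, of f d] p(2) unfolding power_Suc by linarith
    then have mp: "m + 1 \<le> p" using power_less_imp_less_exp[of "2::nat" m p] by simp
    have "2 ^ p \<le> 2 * k * gap f l d" using p h by simp
    also have "\<dots> < 2 * k * (4 * 2 ^ m)" using m(2) k(1) by simp
    also have "\<dots> \<le> 2 * 2 ^ \<kappa> * (4 * 2 ^ m)" using k(2) by simp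
    also have "\<dots> = 2 ^ (m + (\<kappa> + 3))" by (simp add: power_add)
    finally have "p < m + (\<kappa> + 3)" using power_less_imp_less_exp[of "2::nat" p "m + (\<kappa> + 3)"] by simp
    moreover have "m < n"
    proof -
      have "m < 2 ^ m" by (rule less_exp)
      then show ?thesis using m(1) h(4) by linarith
    qed
    ultimately have "(m, p) \<in> I" using mp by (simp add: I_def)
    moreover have "(d, l) \<in> A (m, p)"
      using m p h gap_match[OF l1, of d _ f] by (auto simp: A_def gap_pairs_def)
    ultimately show "(d, l) \<in> (\<Union>i\<in>I. A i)" by blast
  qed
  have le: "sum g (A (m, p)) \<le> 4 * (real (card (gap_pairs f n m p)) * 2 ^ m / 2 ^ p)" for m p
  proof -
    have "sum g (A (m, p)) \<le> (\<Sum>e\<in>A (m, p). 4 * 2 ^ m / 2 ^ p)"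
    proof (rule sum_mono, clarify)
      fix d l assume "(d, l) \<in> A (m, p)"
      then have "gap f l d \<le> 4 * 2 ^ m" "2 ^ p \<le> l" by (auto simp: A_def gap_pairs_def)
      then have "real (gap f l d) \<le> real (4 * 2 ^ m)" "real (2 ^ p) \<le> real l"
        by (simp_all only: of_nat_le_iff)
      then show "g (d, l) \<le> 4 * 2 ^ m / 2 ^ p" by (simp add: g_def frac_le)
    qed
    also have "\<dots> = real (card (A (m, p))) * (4 * 2 ^ m / 2 ^ p)" by simp
    also have "\<dots> \<le> real (card (gap_pairs f n m p)) * (4 * 2 ^ m / 2 ^ p)"
      using card_mono[OF finite_gap_pairs, of "A (m, p)" f n m p]
      by (intro mult_right_mono) (auto simp: A_def)
    finally show ?thesis by (simp add: mult.commute mult.left_commute)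
  qed
  have "sum g (heavy_pairs f n k) \<le> (\<Sum>i\<in>I. sum g (A i))"
    by (rule sum_cover_le[OF _ finA cover]) (auto simp: I_def g_def split: prod.splits)
  also have "\<dots> \<le> (\<Sum>(m, p)\<in>I. 4 * (real (card (gap_pairs f n m p)) * 2 ^ m / 2 ^ p))"
    by (intro sum_mono) (use le in \<open>auto split: prod.splits\<close>)
  also have "\<dots> = 4 * (\<Sum>m<n. \<Sum>p\<in>{m + 1..m + (\<kappa> + 2)}. real (card (gap_pairs f n m p)) * 2 ^ m / 2 ^ p)"
    unfolding I_def sum_distrib_left by (subst sum.Sigma) auto
  also have "\<dots> \<le> 4 * (96 * real (\<kappa> + 2) * real n)"
    by (intro mult_left_mono sum_card_gap_pairs_le) simp
  finally show ?thesis by (simp add: g_def algebra_simps)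
qed

text \<open>Periods up to \<open>2 * k\<close> contribute at most \<open>2 * n * k\<close> windows;
  the longer ones give \<open>2 * 384 = 768\<close> times the product.\<close>

lemma card_mismatch_squares_le:
  fixes f :: "nat \<Rightarrow> 'a"
  assumes k: "1 \<le> k" "k \<le> 2 ^ \<kappa>"
  shows "real (card (mismatch_squares f n k)) \<le> 770 * real n * real k * real (\<kappa> + 2)"
proof -
  let ?D = "mismatch_squares f n k"
  define S where "S = {a \<in> ?D. snd a \<le> 2 * k}"
  define L where "L = {a \<in> ?D. 2 * k < snd a}"
  have "?D = S \<union> L" by (auto simp: S_def L_def)
  then have "card ?D \<le> card S + card L" by (metis card_Un_le)
  then have "real (card ?D) \<le> real (card S) + real (card L)" by linarith
  moreover have "real (card S) \<le> 2 * real n * real k"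
  proof -
    have "S \<subseteq> {1..n} \<times> {1..2 * k}" by (auto simp: S_def mismatch_squares_def)
    then have "card S \<le> card ({1..n} \<times> {1..2 * k})" by (rule card_mono[rotated]) simp
    then have "card S \<le> n * (2 * k)" by (simp add: card_cartesian_product)
    then have "real (card S) \<le> real (n * (2 * k))" by (simp only: of_nat_le_iff)
    then show ?thesis by simp
  qed
  moreover have "real (card L) \<le> 2 * real k * (384 * real (\<kappa> + 2) * real n)"
    using card_long_squares_le[OF k(1), of f n] mult_left_mono[OF sum_heavy_pairs_le[OF k, of f n], of "2 * real k"]
    unfolding L_def by simp
  moreover have "2 * real k * (384 * real (\<kappa> + 2) * real n) = 768 * (real n * real k * real (\<kappa> + 2))"
    by simp
  moreover have "real n * real k \<le> real n * real k * real (\<kappa> + 2)"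
    using mult_left_mono[of 1 "real (\<kappa> + 2)" "real n * real k"] by simp
  ultimately show ?thesis by linarith
qed

section \<open>Uniform runs\<close>

text \<open>Sliding the window drops \<open>i\<close> and gains \<open>i + l\<close>, and neither is
  a mismatch.\<close>

lemma mismatches_Suc:
  assumes "char_at T i = char_at T (i + l)" "char_at T (i + l) = char_at T (i + 2 * l)"
  shows "mismatches T l (Suc i) = mismatches T l i"
proof -
  have "j \<noteq> i" "j \<noteq> i + l" if "char_at T j \<noteq> char_at T (j + l)" for j
    using that assms by (auto simp: mult_2 add.assoc)
  then show ?thesis unfolding mismatches_def
    by (auto simp: le_less Suc_le_eq less_Suc_eq)
qed

lemma uniform_run_shrink_left:
  "uniform_run k T a b l \<Longrightarrow> a \<le> a' \<Longrightarrow> a' + 2 * l \<le> b \<Longrightarrow> uniform_run k T a' b l"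
  unfolding uniform_run_def by auto

text \<open>The only new window is the successor of the last one and has the same mismatches. Hence
  a run that stops before the end of the string has a mismatch at \<open>b - 2 * l\<close> or at
  \<open>b - l\<close>.\<close>

lemma uniform_run_extend_right:
  assumes run: "uniform_run k T a b l" and b: "b \<le> length T"
    and eq: "char_at T (b - 2 * l) = char_at T (b - l)" "char_at T (b - l) = char_at T b"
  shows "uniform_run k T a (b + 1) l"
proof -
  define i where "i = b - 2 * l"
  have i: "a \<le> i" "b = i + 2 * l" using uniform_run_bounds[OF run] i_def by auto
  have "mismatches T l (Suc i) = mismatches T l i"
    using eq i by (intro mismatches_Suc) (auto simp: add.commute)
  moreover have "mismatches T l x = mismatches T l i" if "x \<in> {a..b - 2 * l}" for x
    using run that i unfolding uniform_run_def by (metis atLeastAtMost_iff i_def le_refl)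
  moreover have "{a..b + 1 - 2 * l} = insert (Suc i) {a..b - 2 * l}"
    using i by auto
  ultimately have "mismatches T l x = mismatches T l i" if "x \<in> {a..b + 1 - 2 * l}" for x
    using that by (metis insertE)
  moreover have "card (mismatches T l i) \<le> k"
    using run i unfolding uniform_run_def by (metis atLeastAtMost_iff i_def le_refl)
  ultimately show ?thesis
    using uniform_run_bounds[OF run] b unfolding uniform_run_def by simp
qed

text \<open>Runs may be shortened on the left, so the shorter of two runs with a common end could be
  extended by one position.\<close>

lemma maximal_uniform_run_start_unique:
  assumes "maximal_uniform_run k T a b l" "maximal_uniform_run k T a' b l"
  shows "a = a'"
proof -
  have "\<not> a < a'" if "maximal_uniform_run k T a b l" "maximal_uniform_run k T a' b l" for a a'
  proof
    assume "a < a'"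
    moreover have "a' + 2 * l \<le> b"
      using that(2) uniform_run_bounds(4) by (auto simp: maximal_uniform_run_def)
    ultimately have "uniform_run k T (a' - 1) b l"
      using that(1) uniform_run_shrink_left[of k T a b l "a' - 1"] by (auto simp: maximal_uniform_run_def)
    then show False using that(2) by (simp add: maximal_uniform_run_def)
  qed
  then show ?thesis using assms by (meson linorder_neqE_nat)
qed

text \<open>Either the last window starts with a mismatch, or the position just behind it is one;
  reversing the string turns that position into the start of a window.\<close>

lemma maximal_uniform_run_end_cases:
  assumes "maximal_uniform_run k T a b l"
  defines "f \<equiv> char_at T" and "n \<equiv> length T"
  shows "b = n + 1 \<or> (b - 2 * l, l) \<in> mismatch_squares f n k \<or>
    (n + 1 - b, l) \<in> mismatch_squares (\<lambda>x. f (n + 1 - x)) n (k + 1)"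
proof (cases "b = n + 1")
  case False
  have run: "uniform_run k T a b l" using assms(1) by (simp add: maximal_uniform_run_def)
  define i where "i = b - 2 * l"
  have i: "b = i + 2 * l" "1 \<le> i" "1 \<le> l" "b \<le> n"
    using uniform_run_bounds[OF run] False i_def n_def by auto
  have "b - 2 * l \<in> {a..b - 2 * l}" using uniform_run_bounds[OF run] by simp
  then have card: "card {j \<in> {i..<i + l}. f j \<noteq> f (j + l)} \<le> k"
    using run i_def unfolding uniform_run_def mismatches_def f_def by blast
  have "f i \<noteq> f (i + l) \<or> f (i + l) \<noteq> f b"
    using uniform_run_extend_right[OF run] assms(1) i
    by (auto simp: f_def n_def maximal_uniform_run_def add.commute)
  then show ?thesis
  proof
    assume "f i \<noteq> f (i + l)"
    then show ?thesis using i card by (simp add: mismatch_squares_def)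
  next
    assume mis: "f (i + l) \<noteq> f b"
    define f' where "f' = (\<lambda>x. f (n + 1 - x))"
    define i' where "i' = n + 1 - b"
    define W where "W = {j \<in> {i..<i + l}. f j \<noteq> f (j + l)}"
    \<comment> \<open>In the original string the reversed window is \<open>{i + 1..i + l}\<close>.
      It gains the mismatch \<open>i + l\<close>, which corresponds to \<open>i'\<close>; hence
      \<open>k + 1\<close>.\<close>
    have "{j \<in> {i'..<i' + l}. f' j \<noteq> f' (j + l)} \<subseteq> insert i' ((\<lambda>j. n + 1 - l - j) ` W)"
    proof clarify
      fix j assume j: "j \<in> {i'..<i' + l}" "f' j \<noteq> f' (j + l)" "j \<notin> (\<lambda>j. n + 1 - l - j) ` W"
      show "j = i'"
      proof (rule ccontr)
        assume "j \<noteq> i'"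
        define j0 where "j0 = n + 1 - l - j"
        have "n + 1 - j = j0 + l" "n + 1 - (j + l) = j0" "j = n + 1 - l - j0" "i \<le> j0" "j0 < i + l"
          using j(1) \<open>j \<noteq> i'\<close> i unfolding j0_def i'_def atLeastLessThan_iff by linarith+
        then show False using j(2,3) unfolding W_def f'_def by auto
      qed
    qed
    then have "card {j \<in> {i'..<i' + l}. f' j \<noteq> f' (j + l)} \<le> card (insert i' ((\<lambda>j. n + 1 - l - j) ` W))"
      by (rule card_mono[rotated]) (simp add: W_def)
    also have "\<dots> \<le> Suc (card ((\<lambda>j. n + 1 - l - j) ` W))" by (simp add: card_insert_if W_def)
    also have "\<dots> \<le> Suc (card W)" by (simp add: card_image_le W_def)
    also have "\<dots> \<le> k + 1" using card W_def by simp
    finally have "card {j \<in> {i'..<i' + l}. f' j \<noteq> f' (j + l)} \<le> k + 1" .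
    moreover have "f' i' \<noteq> f' (i' + l)"
    proof -
      have "n + 1 - i' = b" "n + 1 - (i' + l) = i + l" using i i'_def by auto
      then show ?thesis using mis by (simp add: f'_def)
    qed
    moreover have "1 \<le> i'" "i' + 2 * l \<le> n" using i i'_def by auto
    ultimately have "(i', l) \<in> mismatch_squares f' n (k + 1)"
      using i(3) by (simp add: mismatch_squares_def)
    then show ?thesis by (simp add: f'_def i'_def)
  qed
qed simp

text \<open>A maximal run is determined by \<open>(b, l)\<close>. The end \<open>n + 1\<close>
  admits at most \<open>n\<close> periods, and any other end is recovered from a window in the
  string or its reversal.\<close>

lemma card_maximal_uniform_runs_le:
  fixes T :: "'a list"
  defines "f \<equiv> char_at T" and "n \<equiv> length T"
  shows "card (maximal_uniform_runs k T) \<le> n + card (mismatch_squares f n k) +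
    card (mismatch_squares (\<lambda>x. f (n + 1 - x)) n (k + 1))"
proof -
  define D1 where "D1 = mismatch_squares f n k"
  define D2 where "D2 = mismatch_squares (\<lambda>x. f (n + 1 - x)) n (k + 1)"
  define B0 where "B0 = {n + 1} \<times> {1..n}"
  define B1 where "B1 = (\<lambda>(i, l). (i + 2 * l, l)) ` D1"
  define B2 where "B2 = (\<lambda>(i, l). (n + 1 - i, l)) ` D2"
  have fin: "finite D1" "finite D2" by (simp_all add: D1_def D2_def finite_mismatch_squares)
  have "inj_on (\<lambda>(a, b, l). (b, l)) (maximal_uniform_runs k T)"
    by (auto simp: inj_on_def maximal_uniform_runs_def intro: maximal_uniform_run_start_unique)
  then have "card (maximal_uniform_runs k T) = card ((\<lambda>(a, b, l). (b, l)) ` maximal_uniform_runs k T)"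
    by (simp add: card_image)
  also have "\<dots> \<le> card (B0 \<union> B1 \<union> B2)"
  proof (rule card_mono)
    show "finite (B0 \<union> B1 \<union> B2)" using fin by (simp add: B0_def B1_def B2_def)
    show "(\<lambda>(a, b, l). (b, l)) ` maximal_uniform_runs k T \<subseteq> B0 \<union> B1 \<union> B2"
    proof clarify
      fix a b l assume r: "(a, b, l) \<in> maximal_uniform_runs k T" and n: "(b, l) \<notin> B2" "(b, l) \<notin> B1"
      have run: "maximal_uniform_run k T a b l" "1 \<le> l" "l \<le> n"
        using r by (auto simp: maximal_uniform_runs_def n_def)
      have bd: "b \<le> n + 1" "a + 2 * l \<le> b"
        using run(1) uniform_run_bounds[of k T a b l] by (auto simp: maximal_uniform_run_def n_def)
      have "(b - 2 * l, l) \<notin> D1"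
      proof
        assume "(b - 2 * l, l) \<in> D1"
        then have "(\<lambda>(i, l). (i + 2 * l, l)) (b - 2 * l, l) \<in> B1" unfolding B1_def by (rule imageI)
        then show False using n(2) bd by simp
      qed
      moreover have "(n + 1 - b, l) \<notin> D2"
      proof
        assume "(n + 1 - b, l) \<in> D2"
        then have "(\<lambda>(i, l). (n + 1 - i, l)) (n + 1 - b, l) \<in> B2" unfolding B2_def by (rule imageI)
        then show False using n(1) bd by simp
      qed
      ultimately show "(b, l) \<in> B0"
        using maximal_uniform_run_end_cases[OF run(1)] run(2,3)
        by (auto simp: B0_def D1_def D2_def f_def n_def)
    qed
  qed
  also have "\<dots> \<le> card B0 + card B1 + card B2"
    using card_Un_le[of "B0 \<union> B1" B2] card_Un_le[of B0 B1] by linarith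
  also have "\<dots> \<le> n + card D1 + card D2"
    using card_image_le[OF fin(1)] card_image_le[OF fin(2)]
    by (intro add_mono) (auto simp: B0_def B1_def B2_def card_cartesian_product)
  finally show ?thesis by (simp add: D1_def D2_def)
qed

theorem theorem12:
  "\<exists>C::real. C > 0 \<and>
     (\<forall>(k::nat) (T::'a list). k \<ge> 1 \<longrightarrow>
        real (card (maximal_uniform_runs k T))
          \<le> C * (real (length T) * real k * max 1 (log 2 (real k))))"
\<comment> \<open>The constant is \<open>1 + 770 * 4 + 770 * 2 * 4\<close>.\<close>
proof (intro exI[of _ 9241] conjI allI impI)
  fix k :: nat and T :: "'a list" assume k: "k \<ge> 1"
  define f where "f = char_at T"
  define n where "n = length T"
  define M where "M = max 1 (log 2 (real k))"
  \<comment> \<open>The exponent \<open>\<kappa> = Suc t\<close> serves both \<open>k\<close> and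
    \<open>k + 1\<close>, since \<open>k < 2 ^ Suc t\<close>.\<close>
  obtain t where t: "2 ^ t \<le> k" "k < 2 ^ Suc t" using k by (rule power2_bracket)
  have "real t \<le> log 2 (real k)"
    using t(1) k by (simp add: le_log_iff powr_realpow numeral_power_le_of_nat_cancel_iff)
  \<comment> \<open>Here \<open>t \<le> M\<close> and \<open>3 \<le> 3 * M\<close>; the latter is
    where the maximum with 1 enters.\<close>
  then have tM: "real (Suc t + 2) \<le> 4 * M" by (auto simp: M_def)
  have "real (card (maximal_uniform_runs k T)) \<le> real n + real (card (mismatch_squares f n k)) +
      real (card (mismatch_squares (\<lambda>x. f (n + 1 - x)) n (k + 1)))"
    using card_maximal_uniform_runs_le[of k T] by (simp add: f_def n_def flip: of_nat_add)
  also have "\<dots> \<le> real n + 770 * real n * real k * real (Suc t + 2) + 770 * real n * real (k + 1) * real (Suc t + 2)"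
    by (intro add_mono card_mismatch_squares_le order.refl) (use k t in auto)
  also have "\<dots> \<le> real n * real k * M + 770 * real n * real k * (4 * M) + 770 * real n * (2 * real k) * (4 * M)"
  proof (intro add_mono mult_mono tM)
    have "1 * 1 \<le> real k * M" using k by (intro mult_mono) (auto simp: M_def)
    then show "real n \<le> real n * real k * M"
      using mult_left_mono[of 1 "real k * M" "real n"] by (simp add: mult.assoc)
  qed (use k in \<open>auto simp: M_def\<close>)
  also have "\<dots> = 9241 * (real n * real k * M)" by simp
  finally show "real (card (maximal_uniform_runs k T))
      \<le> 9241 * (real (length T) * real k * max 1 (log 2 (real k)))"
    by (simp add: n_def M_def)
qed simp

end
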